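(* Over ${\sf RCA}_0$, the following are equivalent: (1) ${\sf ACA}_0$. (2) If $H$ is a hypergraph with finite edges represented by a sequence of edges (a sequence of finite set codes), then $H$ can be represented by a set of edges (a set of finite set codes consisting exactly of the codes of the edges of $H$).
   Context: ${\sf RCA}_0$ is the base system of second order arithmetic with recursive comprehension and $\Sigma^0_1$ induction; ${\sf ACA}_0$ is ${\sf RCA}_0$ plus arithmetical comprehension. A hypergraph consists of a set $V\subseteq\mathbb{N}$ of vertices and a collection of edges, each edge a subset of $V$. When all edges are finite, each edge can be coded by a single natural number, and the edges may be represented either by a set of such codes or by a sequence of such codes. *)

theory Defs
  imports Main
begin

section \<open>The language of second order arithmetic\<close>

text \<open>Number variables and set variables are two separate families, each indexed by \<^typ>\<open>nat\<close>.\<close>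

datatype tm = Var nat | Zero | One | Add tm tm | Mul tm tm

datatype fm =
    Eq tm tm | Less tm tm | Mem tm nat
  | Neg fm | Conj fm fm | Disj fm fm | Imp fm fm | Iff fm fm
  | AllN nat fm | ExN nat fm
  | AllS nat fm | ExS nat fm

primrec tm_vars :: "tm \<Rightarrow> nat set" where
  "tm_vars (Var x) = {x}"
| "tm_vars Zero = {}"
| "tm_vars One = {}"
| "tm_vars (Add s t) = tm_vars s \<union> tm_vars t"
| "tm_vars (Mul s t) = tm_vars s \<union> tm_vars t"

primrec free_set_vars :: "fm \<Rightarrow> nat set" where
  "free_set_vars (Eq s t) = {}"
| "free_set_vars (Less s t) = {}"
| "free_set_vars (Mem t X) = {X}"
| "free_set_vars (Neg p) = free_set_vars p"
| "free_set_vars (Conj p q) = free_set_vars p \<union> free_set_vars q"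
| "free_set_vars (Disj p q) = free_set_vars p \<union> free_set_vars q"
| "free_set_vars (Imp p q) = free_set_vars p \<union> free_set_vars q"
| "free_set_vars (Iff p q) = free_set_vars p \<union> free_set_vars q"
| "free_set_vars (AllN x p) = free_set_vars p"
| "free_set_vars (ExN x p) = free_set_vars p"
| "free_set_vars (AllS X p) = free_set_vars p - {X}"
| "free_set_vars (ExS X p) = free_set_vars p - {X}"

primrec tm_subst :: "nat \<Rightarrow> tm \<Rightarrow> tm \<Rightarrow> tm" where
  "tm_subst x u (Var y) = (if y = x then u else Var y)"
| "tm_subst x u Zero = Zero"
| "tm_subst x u One = One"
| "tm_subst x u (Add s t) = Add (tm_subst x u s) (tm_subst x u t)"
| "tm_subst x u (Mul s t) = Mul (tm_subst x u s) (tm_subst x u t)"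

text \<open>Replacement of the free occurrences of the number variable \<open>x\<close> by the term \<open>u\<close>, without
  renaming of bound variables. It is used only for \<open>u\<close> with \<open>tm_vars u \<subseteq> {x}\<close>, where no
  variable can be captured (lemma \<open>sat_subst\<close> below).\<close>

primrec subst :: "nat \<Rightarrow> tm \<Rightarrow> fm \<Rightarrow> fm" where
  "subst x u (Eq s t) = Eq (tm_subst x u s) (tm_subst x u t)"
| "subst x u (Less s t) = Less (tm_subst x u s) (tm_subst x u t)"
| "subst x u (Mem t X) = Mem (tm_subst x u t) X"
| "subst x u (Neg p) = Neg (subst x u p)"
| "subst x u (Conj p q) = Conj (subst x u p) (subst x u q)"
| "subst x u (Disj p q) = Disj (subst x u p) (subst x u q)"
| "subst x u (Imp p q) = Imp (subst x u p) (subst x u q)"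
| "subst x u (Iff p q) = Iff (subst x u p) (subst x u q)"
| "subst x u (AllN y p) = AllN y (if y = x then p else subst x u p)"
| "subst x u (ExN y p) = ExN y (if y = x then p else subst x u p)"
| "subst x u (AllS X p) = AllS X (subst x u p)"
| "subst x u (ExS X p) = ExS X (subst x u p)"


section \<open>Structures and satisfaction\<close>

text \<open>The first order part is the whole type \<^typ>\<open>'a\<close>; set variables range over \<open>sets\<close>, which is an
  arbitrary nonempty family of subsets of it (Henkin semantics).\<close>

record 'a interp =
  zero :: 'a
  one :: 'a
  add :: "'a \<Rightarrow> 'a \<Rightarrow> 'a"
  mul :: "'a \<Rightarrow> 'a \<Rightarrow> 'a"
  less :: "'a \<Rightarrow> 'a \<Rightarrow> bool"
  sets :: "'a set set"

definition L2_structure :: "'a interp \<Rightarrow> bool" where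
  "L2_structure M \<longleftrightarrow> sets M \<noteq> {}"

primrec tm_val :: "'a interp \<Rightarrow> (nat \<Rightarrow> 'a) \<Rightarrow> tm \<Rightarrow> 'a" where
  "tm_val M e (Var x) = e x"
| "tm_val M e Zero = zero M"
| "tm_val M e One = one M"
| "tm_val M e (Add s t) = add M (tm_val M e s) (tm_val M e t)"
| "tm_val M e (Mul s t) = mul M (tm_val M e s) (tm_val M e t)"

primrec sat :: "'a interp \<Rightarrow> (nat \<Rightarrow> 'a) \<Rightarrow> (nat \<Rightarrow> 'a set) \<Rightarrow> fm \<Rightarrow> bool" where
  "sat M e E (Eq s t) \<longleftrightarrow> tm_val M e s = tm_val M e t"
| "sat M e E (Less s t) \<longleftrightarrow> less M (tm_val M e s) (tm_val M e t)"
| "sat M e E (Mem t X) \<longleftrightarrow> tm_val M e t \<in> E X"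
| "sat M e E (Neg p) \<longleftrightarrow> \<not> sat M e E p"
| "sat M e E (Conj p q) \<longleftrightarrow> sat M e E p \<and> sat M e E q"
| "sat M e E (Disj p q) \<longleftrightarrow> sat M e E p \<or> sat M e E q"
| "sat M e E (Imp p q) \<longleftrightarrow> (sat M e E p \<longrightarrow> sat M e E q)"
| "sat M e E (Iff p q) \<longleftrightarrow> (sat M e E p \<longleftrightarrow> sat M e E q)"
| "sat M e E (AllN x p) \<longleftrightarrow> (\<forall>a. sat M (e(x := a)) E p)"
| "sat M e E (ExN x p) \<longleftrightarrow> (\<exists>a. sat M (e(x := a)) E p)"
| "sat M e E (AllS X p) \<longleftrightarrow> (\<forall>A\<in>sets M. sat M e (E(X := A)) p)"
| "sat M e E (ExS X p) \<longleftrightarrow> (\<exists>A\<in>sets M. sat M e (E(X := A)) p)"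

text \<open>A structure is a model of a formula with free variables if it satisfies its universal closure.\<close>

definition models :: "'a interp \<Rightarrow> fm set \<Rightarrow> bool" where
  "models M T \<longleftrightarrow> (\<forall>p\<in>T. \<forall>e E. range E \<subseteq> sets M \<longrightarrow> sat M e E p)"


section \<open>Formula classes and axiom systems\<close>

inductive bounded_fm :: "fm \<Rightarrow> bool" where
  "bounded_fm (Eq s t)"
| "bounded_fm (Less s t)"
| "bounded_fm (Mem t X)"
| "bounded_fm p \<Longrightarrow> bounded_fm (Neg p)"
| "bounded_fm p \<Longrightarrow> bounded_fm q \<Longrightarrow> bounded_fm (Conj p q)"
| "bounded_fm p \<Longrightarrow> bounded_fm q \<Longrightarrow> bounded_fm (Disj p q)"
| "bounded_fm p \<Longrightarrow> bounded_fm q \<Longrightarrow> bounded_fm (Imp p q)"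
| "bounded_fm p \<Longrightarrow> bounded_fm q \<Longrightarrow> bounded_fm (Iff p q)"
| "bounded_fm p \<Longrightarrow> x \<notin> tm_vars t \<Longrightarrow> bounded_fm (AllN x (Imp (Less (Var x) t) p))"
| "bounded_fm p \<Longrightarrow> x \<notin> tm_vars t \<Longrightarrow> bounded_fm (ExN x (Conj (Less (Var x) t) p))"

definition Sigma01 :: "fm set" where
  "Sigma01 = {ExN x p |x p. bounded_fm p}"

definition Pi01 :: "fm set" where
  "Pi01 = {AllN x p |x p. bounded_fm p}"

primrec arithmetical :: "fm \<Rightarrow> bool" where
  "arithmetical (Eq s t) \<longleftrightarrow> True"
| "arithmetical (Less s t) \<longleftrightarrow> True"
| "arithmetical (Mem t X) \<longleftrightarrow> True"
| "arithmetical (Neg p) \<longleftrightarrow> arithmetical p"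
| "arithmetical (Conj p q) \<longleftrightarrow> arithmetical p \<and> arithmetical q"
| "arithmetical (Disj p q) \<longleftrightarrow> arithmetical p \<and> arithmetical q"
| "arithmetical (Imp p q) \<longleftrightarrow> arithmetical p \<and> arithmetical q"
| "arithmetical (Iff p q) \<longleftrightarrow> arithmetical p \<and> arithmetical q"
| "arithmetical (AllN x p) \<longleftrightarrow> arithmetical p"
| "arithmetical (ExN x p) \<longleftrightarrow> arithmetical p"
| "arithmetical (AllS X p) \<longleftrightarrow> False"
| "arithmetical (ExS X p) \<longleftrightarrow> False"

definition basic_axioms :: "fm set" where
  "basic_axioms = (let m = Var 0; n = Var 1 in
    {Neg (Eq (Add n One) Zero),
     Imp (Eq (Add m One) (Add n One)) (Eq m n),
     Eq (Add m Zero) m,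
     Eq (Add m (Add n One)) (Add (Add m n) One),
     Eq (Mul m Zero) Zero,
     Eq (Mul m (Add n One)) (Add (Mul m n) m),
     Neg (Less m Zero),
     Iff (Less m (Add n One)) (Disj (Less m n) (Eq m n))})"

definition induction_axiom :: "nat \<Rightarrow> fm \<Rightarrow> fm" where
  "induction_axiom x p =
     Imp (Conj (subst x Zero p) (AllN x (Imp p (subst x (Add (Var x) One) p)))) (AllN x p)"

definition comprehension_axiom :: "nat \<Rightarrow> nat \<Rightarrow> fm \<Rightarrow> fm" where
  "comprehension_axiom X x p = ExS X (AllN x (Iff (Mem (Var x) X) p))"

definition Sigma01_induction :: "fm set" where
  "Sigma01_induction = {induction_axiom x p |x p. p \<in> Sigma01}"

definition Delta01_comprehension :: "fm set" where
  "Delta01_comprehension =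
     {Imp (AllN x (Iff p q)) (comprehension_axiom X x p) |X x p q.
        p \<in> Sigma01 \<and> q \<in> Pi01 \<and> X \<notin> free_set_vars p}"

definition arithmetical_comprehension :: "fm set" where
  "arithmetical_comprehension =
     {comprehension_axiom X x p |X x p. arithmetical p \<and> X \<notin> free_set_vars p}"

definition RCA0 :: "fm set" where
  "RCA0 = basic_axioms \<union> Sigma01_induction \<union> Delta01_comprehension"

definition ACA0 :: "fm set" where
  "ACA0 = RCA0 \<union> arithmetical_comprehension"


section \<open>Hypergraphs with finite edges\<close>

text \<open>The pairing function is \<open>(s + t)\<^sup>2 + s\<close>. Below, number variables from 100 on are reserved for
  bound variables of the defined formulas, whose arguments only use number variables below 100.\<close>

definition pair :: "tm \<Rightarrow> tm \<Rightarrow> tm" where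
  "pair s t = Add (Mul (Add s t) (Add s t)) s"

text \<open>A number \<open>(k, (m, n))\<close> determines the finite set of all \<open>i < k\<close> such that \<open>m (i + 1) + 1\<close>
  divides \<open>n\<close>. Every finite set is determined by many triples; its code is the least one.\<close>

definition triple_fm :: "tm \<Rightarrow> fm" where
  "triple_fm c = ExN 100 (ExN 101 (ExN 102 (Eq c (pair (Var 100) (pair (Var 101) (Var 102))))))"

definition elem_fm :: "tm \<Rightarrow> tm \<Rightarrow> fm" where
  "elem_fm i c = ExN 100 (ExN 101 (ExN 102 (Conj
     (Eq c (pair (Var 100) (pair (Var 101) (Var 102))))
     (Conj (Less i (Var 100))
       (ExN 103 (Eq (Mul (Add (Mul (Var 101) (Add i One)) One) (Var 103)) (Var 102)))))))"

definition fin_code_fm :: "tm \<Rightarrow> fm" where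
  "fin_code_fm c = Conj (triple_fm c)
     (AllN 104 (Imp
       (Conj (triple_fm (Var 104))
         (AllN 105 (Iff (elem_fm (Var 105) (Var 104)) (elem_fm (Var 105) c))))
       (Neg (Less (Var 104) c))))"

text \<open>\<open>c\<close> is the code of a finite subset of the set \<open>V\<close>.\<close>

definition edge_fm :: "nat \<Rightarrow> tm \<Rightarrow> fm" where
  "edge_fm V c = Conj (fin_code_fm c) (AllN 105 (Imp (elem_fm (Var 105) c) (Mem (Var 105) V)))"

text \<open>A sequence is a set of pairs which is the graph of a total function on the numbers.\<close>

definition sequence_fm :: "nat \<Rightarrow> fm" where
  "sequence_fm F = Conj
     (AllN 0 (Imp (Mem (Var 0) F) (ExN 1 (ExN 2 (Eq (Var 0) (pair (Var 1) (Var 2)))))))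
     (AllN 0 (ExN 1 (Conj (Mem (pair (Var 0) (Var 1)) F)
       (AllN 2 (Imp (Mem (pair (Var 0) (Var 2)) F) (Eq (Var 2) (Var 1)))))))"

definition edge_sequence_fm :: "nat \<Rightarrow> nat \<Rightarrow> fm" where
  "edge_sequence_fm V F = Conj (sequence_fm F)
     (AllN 0 (AllN 1 (Imp (Mem (pair (Var 0) (Var 1)) F) (edge_fm V (Var 1)))))"

definition edge_set_fm :: "nat \<Rightarrow> nat \<Rightarrow> fm" where
  "edge_set_fm V S = AllN 1 (Imp (Mem (Var 1) S) (edge_fm V (Var 1)))"

text \<open>Set variables: vertex set \<open>V = 0\<close>, sequence of edges \<open>F = 1\<close>, set of edges \<open>S = 2\<close>.\<close>

definition hypergraph_sentence :: fm where
  "hypergraph_sentence =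
     AllS 0 (AllS 1 (Imp (edge_sequence_fm 0 1)
       (ExS 2 (Conj (edge_set_fm 0 2)
         (AllN 1 (Iff (Mem (Var 1) 2) (ExN 0 (Mem (pair (Var 0) (Var 1)) 1))))))))"


section \<open>The meaning of the defined formulas\<close>

lemma tm_val_cong: "(\<And>x. x \<in> tm_vars t \<Longrightarrow> e x = e' x) \<Longrightarrow> tm_val M e t = tm_val M e' t"
  by (induction t) auto

lemma tm_val_upd [simp]: "x \<notin> tm_vars t \<Longrightarrow> tm_val M (e(x := a)) t = tm_val M e t"
  by (rule tm_val_cong) auto

lemma tm_val_subst: "tm_val M e (tm_subst x u t) = tm_val M (e(x := tm_val M e u)) t"
  by (induction t) auto

lemma sat_subst:
  assumes "tm_vars u \<subseteq> {x}"
  shows "sat M e E (subst x u p) \<longleftrightarrow> sat M (e(x := tm_val M e u)) E p"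
proof (induction p arbitrary: e E)
  case (AllN y p)
  show ?case
  proof (cases "y = x")
    case False
    then have "y \<notin> tm_vars u" using assms by auto
    then have "sat M (e(y := a)) E (subst x u p) \<longleftrightarrow> sat M (e(x := tm_val M e u, y := a)) E p" for a
      unfolding AllN.IH by (simp only: tm_val_upd fun_upd_twist[OF False] not_False_eq_True)
    with False show ?thesis by (simp del: fun_upd_apply)
  qed (simp del: fun_upd_apply)
next
  case (ExN y p)
  show ?case
  proof (cases "y = x")
    case False
    then have "y \<notin> tm_vars u" using assms by auto
    then have "sat M (e(y := a)) E (subst x u p) \<longleftrightarrow> sat M (e(x := tm_val M e u, y := a)) E p" for a
      unfolding ExN.IH by (simp only: tm_val_upd fun_upd_twist[OF False] not_False_eq_True)
    with False show ?thesis by (simp del: fun_upd_apply)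
  qed (simp del: fun_upd_apply)
qed (auto simp: tm_val_subst)

definition pr :: "'a interp \<Rightarrow> 'a \<Rightarrow> 'a \<Rightarrow> 'a" where
  "pr M a b = add M (mul M (add M a b) (add M a b)) a"

definition elem :: "'a interp \<Rightarrow> 'a \<Rightarrow> 'a \<Rightarrow> bool" where
  "elem M i c \<longleftrightarrow> (\<exists>k m n. c = pr M k (pr M m n) \<and> less M i k \<and>
     (\<exists>q. mul M (add M (mul M m (add M i (one M))) (one M)) q = n))"

definition fin_code :: "'a interp \<Rightarrow> 'a \<Rightarrow> bool" where
  "fin_code M c \<longleftrightarrow> (\<exists>k m n. c = pr M k (pr M m n)) \<and>
     (\<forall>d. (\<exists>k m n. d = pr M k (pr M m n)) \<and> (\<forall>i. elem M i d \<longleftrightarrow> elem M i c) \<longrightarrow> \<not> less M d c)"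

definition edge :: "'a interp \<Rightarrow> 'a set \<Rightarrow> 'a \<Rightarrow> bool" where
  "edge M V c \<longleftrightarrow> fin_code M c \<and> (\<forall>i. elem M i c \<longrightarrow> i \<in> V)"

lemma tm_val_pair [simp]: "tm_val M e (pair s t) = pr M (tm_val M e s) (tm_val M e t)"
  by (simp add: pair_def pr_def)

lemma sat_elem_fm:
  assumes "tm_vars s \<inter> {100..103} = {}" "tm_vars t \<inter> {100..103} = {}"
  shows "sat M e E (elem_fm s t) \<longleftrightarrow> elem M (tm_val M e s) (tm_val M e t)"
proof -
  have "x \<notin> tm_vars s" "x \<notin> tm_vars t" if "x \<in> {100,101,102,103}" for x
    using assms that by auto
  then show ?thesis by (simp add: elem_fm_def elem_def)
qed

lemma sat_edge_fm:
  assumes "tm_vars t \<inter> {100..105} = {}"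
  shows "sat M e E (edge_fm V t) \<longleftrightarrow> edge M (E V) (tm_val M e t)"
proof -
  have "x \<notin> tm_vars t" if "x \<in> {100,101,102,103,104,105}" for x
    using assms that by auto
  moreover have "tm_vars t \<inter> {100..103} = {}" using assms by fastforce
  ultimately show ?thesis
    by (simp add: edge_fm_def edge_def fin_code_fm_def fin_code_def triple_fm_def sat_elem_fm)
qed

lemma sat_hypergraph_sentence:
  "sat M e E hypergraph_sentence \<longleftrightarrow>
     (\<forall>V\<in>sets M. \<forall>F\<in>sets M.
        (\<forall>p\<in>F. \<exists>n c. p = pr M n c) \<and> (\<forall>n. \<exists>!c. pr M n c \<in> F) \<and>
        (\<forall>n c. pr M n c \<in> F \<longrightarrow> edge M V c) \<longrightarrow>
        (\<exists>S\<in>sets M. (\<forall>c\<in>S. edge M V c) \<and> (\<forall>c. c \<in> S \<longleftrightarrow> (\<exists>n. pr M n c \<in> F))))"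
  by (simp add: hypergraph_sentence_def edge_sequence_fm_def sequence_fm_def edge_set_fm_def
      sat_edge_fm Ex1_def Ball_def)

end

theory Submission
  imports Defs
begin

text \<open>If a set \<open>Q\<close> of pairs is given, map \<open>(a, b) \<in> Q\<close> to the code of the initial segment
  \<open>{0, \<dots>, a}\<close> and every other number to the code of the empty set. This is a sequence of edges, and
  from the set of its values one computes the projection \<open>{a. \<exists>b. (a, b) \<in> Q}\<close>; so the hypergraph
  principle gives \<open>\<Sigma>\<^sub>1\<close> comprehension with parameters. Eliminating quantifiers from the inside out,
  each arithmetical formula is then equivalent to a formula \<open>t \<in> A\<close>, with \<open>t\<close> a term coding the free
  variables and \<open>A\<close> a set of the model. The other direction is a single instance of arithmetical
  comprehension.\<close>

section \<open>Coincidence of satisfaction\<close>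

primrec free_num_vars :: "fm \<Rightarrow> nat set" where
  "free_num_vars (Eq s t) = tm_vars s \<union> tm_vars t"
| "free_num_vars (Less s t) = tm_vars s \<union> tm_vars t"
| "free_num_vars (Mem t X) = tm_vars t"
| "free_num_vars (Neg p) = free_num_vars p"
| "free_num_vars (Conj p q) = free_num_vars p \<union> free_num_vars q"
| "free_num_vars (Disj p q) = free_num_vars p \<union> free_num_vars q"
| "free_num_vars (Imp p q) = free_num_vars p \<union> free_num_vars q"
| "free_num_vars (Iff p q) = free_num_vars p \<union> free_num_vars q"
| "free_num_vars (AllN x p) = free_num_vars p - {x}"
| "free_num_vars (ExN x p) = free_num_vars p - {x}"
| "free_num_vars (AllS X p) = free_num_vars p"
| "free_num_vars (ExS X p) = free_num_vars p"

lemma finite_tm_vars [simp]: "finite (tm_vars t)"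
  by (induction t) auto

lemma finite_free_num_vars [simp]: "finite (free_num_vars p)"
  by (induction p) auto

lemma finite_free_set_vars [simp]: "finite (free_set_vars p)"
  by (induction p) auto

lemma ex_fresh: "finite A \<Longrightarrow> \<exists>x::nat. x \<notin> A"
  using ex_new_if_finite infinite_UNIV_nat by blast

lemma sat_cong:
  assumes "\<And>x. x \<in> free_num_vars p \<Longrightarrow> e x = e' x"
    and "\<And>X. X \<in> free_set_vars p \<Longrightarrow> E X = E' X"
  shows "sat M e E p \<longleftrightarrow> sat M e' E' p"
  using assms
proof (induction p arbitrary: e e' E E')
  case (Eq s t)
  then show ?case using tm_val_cong[of s e e' M] tm_val_cong[of t e e' M] by simp
next
  case (Less s t)
  then show ?case using tm_val_cong[of s e e' M] tm_val_cong[of t e e' M] by simp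
next
  case (Mem t X)
  then show ?case using tm_val_cong[of t e e' M] by simp
next
  case (Neg p)
  have "sat M e E p = sat M e' E' p" by (rule Neg.IH) (simp_all add: Neg.prems)
  then show ?case by simp
next
  case (Conj p q)
  have "sat M e E p = sat M e' E' p" "sat M e E q = sat M e' E' q"
    by (rule Conj.IH; simp add: Conj.prems)+
  then show ?case by simp
next
  case (Disj p q)
  have "sat M e E p = sat M e' E' p" "sat M e E q = sat M e' E' q"
    by (rule Disj.IH; simp add: Disj.prems)+
  then show ?case by simp
next
  case (Imp p q)
  have "sat M e E p = sat M e' E' p" "sat M e E q = sat M e' E' q"
    by (rule Imp.IH; simp add: Imp.prems)+
  then show ?case by simp
next
  case (Iff p q)
  have "sat M e E p = sat M e' E' p" "sat M e E q = sat M e' E' q"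
    by (rule Iff.IH; simp add: Iff.prems)+
  then show ?case by simp
next
  case (AllN x p)
  have "sat M (e(x := a)) E p = sat M (e'(x := a)) E' p" for a
    by (rule AllN.IH) (simp_all add: AllN.prems)
  then show ?case by simp
next
  case (ExN x p)
  have "sat M (e(x := a)) E p = sat M (e'(x := a)) E' p" for a
    by (rule ExN.IH) (simp_all add: ExN.prems)
  then show ?case by simp
next
  case (AllS X p)
  have "sat M e (E(X := A)) p = sat M e' (E'(X := A)) p" for A
    by (rule AllS.IH) (simp_all add: AllS.prems)
  then show ?case by simp
next
  case (ExS X p)
  have "sat M e (E(X := A)) p = sat M e' (E'(X := A)) p" for A
    by (rule ExS.IH) (simp_all add: ExS.prems)
  then show ?case by simp
qed

lemma sat_upd_fresh: "x \<notin> free_num_vars p \<Longrightarrow> sat M (e(x := a)) E p = sat M e E p"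
  by (rule sat_cong) auto

lemma sat_upd_set_fresh: "X \<notin> free_set_vars p \<Longrightarrow> sat M e (E(X := A)) p = sat M e E p"
  by (rule sat_cong) auto

section \<open>Induction and comprehension for bounded formulas\<close>

locale rca0_model =
  fixes M :: "'a interp"
  assumes nonempty: "L2_structure M" and rca0: "models M RCA0"
begin

abbreviation zeroM :: 'a ("\<zero>") where "\<zero> \<equiv> zero M"
abbreviation oneM :: 'a ("\<one>") where "\<one> \<equiv> one M"
abbreviation addM :: "'a \<Rightarrow> 'a \<Rightarrow> 'a" (infixl "\<oplus>" 65) where "a \<oplus> b \<equiv> add M a b"
abbreviation mulM :: "'a \<Rightarrow> 'a \<Rightarrow> 'a" (infixl "\<otimes>" 70) where "a \<otimes> b \<equiv> mul M a b"
abbreviation lessM :: "'a \<Rightarrow> 'a \<Rightarrow> bool" (infix "\<prec>" 50) where "a \<prec> b \<equiv> less M a b"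

definition some_sets :: "nat \<Rightarrow> 'a set" where
  "some_sets = (\<lambda>_. SOME A. A \<in> sets M)"

lemma range_some_sets: "range some_sets \<subseteq> sets M"
proof -
  have "\<exists>A. A \<in> sets M" using nonempty by (auto simp: L2_structure_def)
  then have "(SOME A. A \<in> sets M) \<in> sets M" by (rule someI_ex)
  then show ?thesis by (auto simp: some_sets_def)
qed

lemma sat_RCA0: "p \<in> RCA0 \<Longrightarrow> range E \<subseteq> sets M \<Longrightarrow> sat M e E p"
  using rca0 by (auto simp: models_def)

lemma sat_basic: "p \<in> basic_axioms \<Longrightarrow> sat M e some_sets p"
  by (rule sat_RCA0) (auto simp: RCA0_def range_some_sets)

lemma
  shows add_one_neq_zero [simp]: "a \<oplus> \<one> \<noteq> \<zero>"
    and add_one_inject: "a \<oplus> \<one> = b \<oplus> \<one> \<Longrightarrow> a = b"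
    and add_zero [simp]: "a \<oplus> \<zero> = a"
    and add_add_one: "a \<oplus> (b \<oplus> \<one>) = a \<oplus> b \<oplus> \<one>"
    and mul_zero [simp]: "a \<otimes> \<zero> = \<zero>"
    and mul_add_one: "a \<otimes> (b \<oplus> \<one>) = a \<otimes> b \<oplus> a"
    and not_less_zero [simp]: "\<not> a \<prec> \<zero>"
    and less_add_one_iff: "a \<prec> b \<oplus> \<one> \<longleftrightarrow> a \<prec> b \<or> a = b"
proof -
  have sats: "\<forall>p\<in>basic_axioms. sat M ((\<lambda>_. \<zero>)(0 := a, 1 := b)) some_sets p"
    using sat_basic by blast
  \<comment> \<open>The axiom that no successor is zero speaks of variable 1 only, so here
    \<open>a\<close> has to be the value of that variable.\<close>
  have sats': "\<forall>p\<in>basic_axioms. sat M ((\<lambda>_. \<zero>)(0 := b, 1 := a)) some_sets p"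
    using sat_basic by blast
  show "a \<oplus> \<one> \<noteq> \<zero>" using sats' by (simp add: basic_axioms_def Let_def)
  show "a \<oplus> \<one> = b \<oplus> \<one> \<Longrightarrow> a = b" "a \<oplus> \<zero> = a" "a \<oplus> (b \<oplus> \<one>) = a \<oplus> b \<oplus> \<one>"
    "a \<otimes> \<zero> = \<zero>" "a \<otimes> (b \<oplus> \<one>) = a \<otimes> b \<oplus> a" "\<not> a \<prec> \<zero>"
    "a \<prec> b \<oplus> \<one> \<longleftrightarrow> a \<prec> b \<or> a = b"
    using sats by (simp_all add: basic_axioms_def Let_def)
qed

lemma Sigma01_induct:
  assumes "bounded_fm p" "range E \<subseteq> sets M"
    and "\<exists>b. sat M (e(x := \<zero>, y := b)) E p"
    and "\<And>a b. sat M (e(x := a, y := b)) E p \<Longrightarrow> \<exists>b. sat M (e(x := a \<oplus> \<one>, y := b)) E p"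
  shows "\<exists>b. sat M (e(x := a, y := b)) E p"
proof -
  have "induction_axiom x (ExN y p) \<in> RCA0"
    using assms(1) by (auto simp: RCA0_def Sigma01_induction_def Sigma01_def)
  note ax = sat_RCA0[OF this assms(2), of e]
  have subst_Zero: "sat M f E (subst x Zero q) = sat M (f(x := \<zero>)) E q"
    and subst_Suc: "sat M f E (subst x (Add (Var x) One) q) = sat M (f(x := f x \<oplus> \<one>)) E q" for f q
    by (simp_all add: sat_subst)
  from ax have "(\<exists>b. sat M (e(x := \<zero>, y := b)) E p) \<and>
      (\<forall>a. (\<exists>b. sat M (e(x := a, y := b)) E p) \<longrightarrow> (\<exists>b. sat M (e(x := a \<oplus> \<one>, y := b)) E p)) \<longrightarrow>
      (\<forall>a. \<exists>b. sat M (e(x := a, y := b)) E p)"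
    unfolding induction_axiom_def sat.simps subst_Zero subst_Suc fun_upd_same fun_upd_upd .
  then show ?thesis using assms(3,4) by blast
qed

lemma bounded_induct:
  assumes "bounded_fm p" "sat M (e(0 := \<zero>)) some_sets p"
    and "\<And>a. sat M (e(0 := a)) some_sets p \<Longrightarrow> sat M (e(0 := a \<oplus> \<one>)) some_sets p"
  shows "sat M (e(0 := a)) some_sets p"
proof -
  obtain y where "y \<notin> free_num_vars p" using ex_fresh by force
  then have fresh: "sat M (f(y := b)) some_sets p = sat M f some_sets p" for f b
    by (rule sat_upd_fresh)
  show ?thesis
    using Sigma01_induct[OF assms(1) range_some_sets, of e 0 y a, unfolded fresh] assms(2,3) by blast
qed

text \<open>A dummy quantifier over a fresh \<open>y\<close> presents \<open>p\<close> both as a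
  \<open>Sigma01\<close> and as a \<open>Pi01\<close> formula, which makes the premise of the
  comprehension axiom trivial.\<close>

lemma bounded_comprehension:
  assumes "bounded_fm p" "range E \<subseteq> sets M"
  shows "{a. sat M (e(x := a)) E p} \<in> sets M"
proof -
  obtain y where y: "y \<notin> free_num_vars p" using ex_fresh by force
  obtain X where X: "X \<notin> free_set_vars p" using ex_fresh by force
  have "ExN y p \<in> Sigma01" "AllN y p \<in> Pi01" "X \<notin> free_set_vars (ExN y p)"
    using assms(1) X by (auto simp: Sigma01_def Pi01_def)
  then have "Imp (AllN x (Iff (ExN y p) (AllN y p))) (comprehension_axiom X x (ExN y p)) \<in> RCA0"
    unfolding RCA0_def Delta01_comprehension_def by blast
  from sat_RCA0[OF this assms(2), of e]
  have "\<exists>A\<in>sets M. \<forall>a. a \<in> A \<longleftrightarrow> sat M (e(x := a)) E p"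
    by (simp add: comprehension_axiom_def sat_upd_fresh[OF y] sat_upd_set_fresh[OF X])
  then obtain A where A: "A \<in> sets M" "\<And>a. a \<in> A \<longleftrightarrow> sat M (e(x := a)) E p" by blast
  then have "{a. sat M (e(x := a)) E p} = A" by auto
  with A(1) show ?thesis by simp
qed

section \<open>Arithmetic in a model\<close>

text \<open>\<open>M\<close> may be nonstandard, so the laws of arithmetic have to come from
  induction inside \<open>M\<close>. In the instances of \<open>bounded_induct\<close>, variable 0
  is the induction variable and the others hold parameters.\<close>

lemma zero_add [simp]: "\<zero> \<oplus> a = a"
  using bounded_induct[of "Eq (Add Zero (Var 0)) (Var 0)" "\<lambda>_. \<zero>" a]
  by (simp add: bounded_fm.intros add_add_one)

lemma add_assoc: "a \<oplus> b \<oplus> c = a \<oplus> (b \<oplus> c)"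
  using bounded_induct[of "Eq (Add (Add (Var 1) (Var 2)) (Var 0)) (Add (Var 1) (Add (Var 2) (Var 0)))"
      "(\<lambda>_. \<zero>)(1 := a, 2 := b)" c]
  by (simp add: bounded_fm.intros add_add_one)

lemma one_add: "\<one> \<oplus> a = a \<oplus> \<one>"
  using bounded_induct[of "Eq (Add One (Var 0)) (Add (Var 0) One)" "\<lambda>_. \<zero>" a]
  by (simp add: bounded_fm.intros add_add_one)

lemma add_commute: "a \<oplus> b = b \<oplus> a"
  using bounded_induct[of "Eq (Add (Var 1) (Var 0)) (Add (Var 0) (Var 1))" "(\<lambda>_. \<zero>)(1 := a)" b]
  by (simp add: bounded_fm.intros) (metis add_assoc one_add)

lemma add_left_commute: "a \<oplus> (b \<oplus> c) = b \<oplus> (a \<oplus> c)"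
  by (metis add_assoc add_commute)

lemmas add_ac = add_assoc add_commute add_left_commute

lemma add_right_cancel [simp]: "a \<oplus> c = b \<oplus> c \<longleftrightarrow> a = b"
  using bounded_induct[of "Imp (Eq (Add (Var 1) (Var 0)) (Add (Var 2) (Var 0))) (Eq (Var 1) (Var 2))"
      "(\<lambda>_. \<zero>)(1 := a, 2 := b)" c]
  by (simp add: bounded_fm.intros) (metis add_add_one add_one_inject)

lemma add_left_cancel [simp]: "c \<oplus> a = c \<oplus> b \<longleftrightarrow> a = b"
  by (metis add_commute add_right_cancel)

lemma add_eq_self [simp]: "a \<oplus> b = a \<longleftrightarrow> b = \<zero>"
  by (metis add_left_cancel add_zero)

lemma zero_mul [simp]: "\<zero> \<otimes> a = \<zero>"
  using bounded_induct[of "Eq (Mul Zero (Var 0)) Zero" "\<lambda>_. \<zero>" a]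
  by (simp add: bounded_fm.intros mul_add_one)

lemma add_one_mul: "(b \<oplus> \<one>) \<otimes> a = b \<otimes> a \<oplus> a"
  using bounded_induct[of "Eq (Mul (Add (Var 1) One) (Var 0)) (Add (Mul (Var 1) (Var 0)) (Var 0))"
      "(\<lambda>_. \<zero>)(1 := b)" a]
  by (simp add: bounded_fm.intros mul_add_one add_ac)

lemma mul_commute: "a \<otimes> b = b \<otimes> a"
  using bounded_induct[of "Eq (Mul (Var 1) (Var 0)) (Mul (Var 0) (Var 1))" "(\<lambda>_. \<zero>)(1 := a)" b]
  by (simp add: bounded_fm.intros mul_add_one add_one_mul)

lemma mul_add: "a \<otimes> (b \<oplus> c) = a \<otimes> b \<oplus> a \<otimes> c"
  using bounded_induct[of "Eq (Mul (Var 1) (Add (Var 2) (Var 0)))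
        (Add (Mul (Var 1) (Var 2)) (Mul (Var 1) (Var 0)))" "(\<lambda>_. \<zero>)(1 := a, 2 := b)" c]
  by (simp add: bounded_fm.intros mul_add_one add_assoc[symmetric])

lemma add_mul: "(b \<oplus> c) \<otimes> a = b \<otimes> a \<oplus> c \<otimes> a"
  by (metis mul_add mul_commute)

lemma mul_one [simp]: "a \<otimes> \<one> = a"
  by (metis mul_add_one mul_zero zero_add)

lemma one_mul [simp]: "\<one> \<otimes> a = a"
  by (metis mul_commute mul_one)

lemma zero_or_add_one: "a = \<zero> \<or> (\<exists>b. a = b \<oplus> \<one>)"
  using Sigma01_induct[of "Disj (Eq (Var 0) Zero) (Eq (Var 0) (Add (Var 1) One))" some_sets
      "\<lambda>_. \<zero>" 0 1 a]
  by (auto simp: bounded_fm.intros range_some_sets)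

section \<open>The order of the model\<close>

lemma less_imp_eq_add: "a \<prec> b \<Longrightarrow> \<exists>c. b = a \<oplus> (c \<oplus> \<one>)"
  using Sigma01_induct[of "Imp (Less (Var 2) (Var 0)) (Eq (Var 0) (Add (Var 2) (Add (Var 1) One)))"
      some_sets "(\<lambda>_. \<zero>)(2 := a)" 0 1 b]
  by (simp add: bounded_fm.intros range_some_sets less_add_one_iff)
    (metis add_assoc zero_add)

lemma less_add: "a \<prec> a \<oplus> (c \<oplus> \<one>)"
  using bounded_induct[of "Less (Var 1) (Add (Var 1) (Add (Var 0) One))" "(\<lambda>_. \<zero>)(1 := a)" c]
  by (simp add: bounded_fm.intros less_add_one_iff add_add_one)

lemma less_iff: "a \<prec> b \<longleftrightarrow> (\<exists>c. b = a \<oplus> (c \<oplus> \<one>))"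
  using less_add less_imp_eq_add by blast

lemma less_irrefl [simp]: "\<not> a \<prec> a"
  by (metis add_eq_self add_one_neq_zero less_iff)

text \<open>The language has only a strict order; \<open>a \<prec> b \<oplus> \<one>\<close> stands
  for \<open>a \<le> b\<close> from here on, and is the form that bounded quantifiers need.\<close>

lemma le_iff: "a \<prec> b \<oplus> \<one> \<longleftrightarrow> (\<exists>c. b = a \<oplus> c)"
  by (metis add_zero less_add_one_iff less_iff zero_or_add_one)

lemma less_linear: "a \<prec> b \<or> a = b \<or> b \<prec> a"
proof -
  have step: "a \<prec> c \<oplus> \<one> \<or> a = c \<oplus> \<one> \<or> c \<oplus> \<one> \<prec> a" if "a \<prec> c \<or> a = c \<or> c \<prec> a" for c
  proof (cases "c \<prec> a")
    case True
    then obtain d where d: "a = c \<oplus> (d \<oplus> \<one>)" using less_imp_eq_add by blast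
    \<comment> \<open>\<open>d\<close> is the gap from \<open>c \<oplus> \<one>\<close> to
      \<open>a\<close>: zero gives equality, a successor gives strict inequality.\<close>
    show ?thesis using zero_or_add_one[of d]
    proof
      assume "\<exists>b. d = b \<oplus> \<one>"
      then obtain b where "d = b \<oplus> \<one>" by blast
      then have "a = c \<oplus> \<one> \<oplus> (b \<oplus> \<one>)" using d by (simp add: add_ac)
      then show ?thesis using less_add by blast
    qed (simp add: d)
  qed (use that in \<open>simp add: less_add_one_iff\<close>)
  have "\<zero> = a \<or> \<zero> \<prec> a" by (metis less_iff zero_add zero_or_add_one)
  with step show ?thesis
    using bounded_induct[of "Disj (Less (Var 1) (Var 0)) (Disj (Eq (Var 1) (Var 0)) (Less (Var 0) (Var 1)))"
      "(\<lambda>_. \<zero>)(1 := a)" b]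
    by (auto simp: bounded_fm.intros)
qed

lemma not_less_imp_le: "\<not> a \<prec> b \<Longrightarrow> \<exists>c. a = b \<oplus> c"
  by (metis le_iff less_add_one_iff less_linear)

lemma add_not_less: "\<not> a \<oplus> c \<prec> a"
proof
  assume "a \<oplus> c \<prec> a"
  then obtain d where "a = a \<oplus> c \<oplus> (d \<oplus> \<one>)" using less_imp_eq_add by blast
  then have "a \<oplus> (c \<oplus> d \<oplus> \<one>) = a" by (simp add: add_assoc)
  then show False by simp
qed

section \<open>Injectivity and monotonicity of pairing\<close>

text \<open>If s = a + b is smaller than the other sum, the other code is at least (s + 1)^2, which
  exceeds s^2 + s and therefore s^2 + a.\<close>

lemma pr_sum_unique: "pr M a b = pr M a' b' \<Longrightarrow> \<not> a \<oplus> b \<prec> a' \<oplus> b'"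
proof
  assume eq: "pr M a b = pr M a' b'" and "a \<oplus> b \<prec> a' \<oplus> b'"
  then obtain u where u: "a' \<oplus> b' = a \<oplus> b \<oplus> (u \<oplus> \<one>)" using less_imp_eq_add by blast
  define s where "s = a \<oplus> b"
  have "(s \<oplus> (u \<oplus> \<one>)) \<otimes> (s \<oplus> (u \<oplus> \<one>)) \<oplus> a'
      = s \<otimes> s \<oplus> s \<oplus> (s \<otimes> u \<oplus> u \<otimes> s \<oplus> s \<oplus> u \<otimes> u \<oplus> u \<oplus> u \<oplus> a' \<oplus> \<one>)"
    by (simp add: mul_add add_mul add_ac)
  \<comment> \<open>One summand \<open>s\<close> is split as \<open>a \<oplus> b\<close>, so that
    \<open>pr M a b\<close> and a positive excess become visible.\<close>
  also have "\<dots> = s \<otimes> s \<oplus> a \<oplus> (b \<oplus> (s \<otimes> u \<oplus> u \<otimes> s \<oplus> s \<oplus> u \<otimes> u \<oplus> u \<oplus> u \<oplus> a') \<oplus> \<one>)"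
    by (subst (3) s_def) (simp only: add_assoc)
  finally show False using eq unfolding pr_def u s_def[symmetric]
    by (metis add_eq_self add_one_neq_zero)
qed

lemma pr_inject [simp]: "pr M a b = pr M a' b' \<longleftrightarrow> a = a' \<and> b = b'"
proof
  assume eq: "pr M a b = pr M a' b'"
  then have sum: "a \<oplus> b = a' \<oplus> b'" using pr_sum_unique less_linear by metis
  with eq have "a = a'" by (simp add: pr_def)
  with sum show "a = a' \<and> b = b'" by simp
qed simp

lemma fst_le_pr: "a \<prec> pr M a b \<oplus> \<one>"
  unfolding le_iff pr_def using add_commute by blast

lemma snd_le_pr: "b \<prec> pr M a b \<oplus> \<one>"
proof -
  have "\<exists>c. s \<otimes> s = s \<oplus> c" for s
    using zero_or_add_one[of s] by (metis add_commute add_zero mul_add_one mul_zero)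
  then obtain c where "(a \<oplus> b) \<otimes> (a \<oplus> b) = a \<oplus> b \<oplus> c" by blast
  then have "pr M a b = b \<oplus> (a \<oplus> c \<oplus> a)" by (simp add: pr_def add_ac)
  then show ?thesis by (auto simp: le_iff)
qed

lemma pr_zero_zero [simp]: "pr M \<zero> \<zero> = \<zero>"
  by (simp add: pr_def)

text \<open>Expanding the square of \<open>x \<oplus> (u \<oplus> y)\<close> leaves the square of
  \<open>x\<close> and a remainder, from which the witness is read off.\<close>

lemma pr_zero_le: "\<exists>w. pr M (x \<oplus> u) y = pr M x \<zero> \<oplus> w"
proof
  show "pr M (x \<oplus> u) y = pr M x \<zero> \<oplus>
      (x \<otimes> (u \<oplus> y) \<oplus> (u \<oplus> y) \<otimes> x \<oplus> (u \<oplus> y) \<otimes> (u \<oplus> y) \<oplus> u)"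
    by (simp add: pr_def mul_add add_mul add_ac)
qed

section \<open>Codes of initial segments\<close>

lemma elem_pr [simp]:
  "elem M i (pr M k (pr M m n)) \<longleftrightarrow> i \<prec> k \<and> (\<exists>q. (m \<otimes> (i \<oplus> \<one>) \<oplus> \<one>) \<otimes> q = n)"
  by (auto simp: elem_def)

text \<open>\<open>\<zero>\<close> codes the pair of zeros; with \<open>m = n = \<zero>\<close> the
  divisor is \<open>\<one>\<close> and divides \<open>n\<close>, so only the bound
  \<open>i \<prec> x\<close> remains.\<close>

lemma elem_initial_segment: "elem M i (pr M x \<zero>) \<longleftrightarrow> i \<prec> x"
  using elem_pr[of i x \<zero> \<zero>] by simp

text \<open>A code of \<open>{i. i < x}\<close> has first component at least \<open>x\<close>, and pairing is monotone, so the least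
  code is the triple \<open>(x, (0, 0))\<close>. This makes initial segments more convenient edges than
  singletons.\<close>

lemma fin_code_initial_segment: "fin_code M (pr M x \<zero>)"
proof -
  have "\<not> pr M k (pr M m n) \<prec> pr M x \<zero>"
    if "\<forall>i. elem M i (pr M k (pr M m n)) \<longleftrightarrow> i \<prec> x" for k m n
  proof -
    have "\<not> k \<prec> x" using that[rule_format, of k] by simp
    then obtain u where "k = x \<oplus> u" using not_less_imp_le by blast
    then show ?thesis using pr_zero_le add_not_less by metis
  qed
  moreover have "pr M x \<zero> = pr M x (pr M \<zero> \<zero>)" by simp
  ultimately show ?thesis unfolding fin_code_def elem_initial_segment by blast
qed

section \<open>Arithmetical comprehension from the hypergraph principle\<close>

text \<open>The components of a pair or tuple do not exceed its code, so decoding the value of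
  \<open>z\<close> takes only quantifiers bounded by \<open>z\<close> and keeps a formula
  bounded.\<close>

definition bexs :: "nat list \<Rightarrow> nat \<Rightarrow> fm \<Rightarrow> fm" where
  "bexs xs z p = foldr (\<lambda>x q. ExN x (Conj (Less (Var x) (Add (Var z) One)) q)) xs p"

definition tuple :: "nat list \<Rightarrow> tm" where
  "tuple xs = foldr (\<lambda>x. pair (Var x)) xs Zero"

lemma bounded_bexs: "bounded_fm p \<Longrightarrow> z \<notin> set xs \<Longrightarrow> bounded_fm (bexs xs z p)"
  by (induction xs) (auto simp: bexs_def intro!: bounded_fm.intros)

lemma sat_bexs:
  "z \<notin> set xs \<Longrightarrow> sat M e E (bexs xs z p) \<longleftrightarrow>
    (\<exists>f. (\<forall>v. v \<notin> set xs \<longrightarrow> f v = e v) \<and> (\<forall>v\<in>set xs. f v \<prec> e z \<oplus> \<one>) \<and> sat M f E p)"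
proof (induction xs arbitrary: e)
  case Nil
  have "(\<forall>v. f v = e v) \<longleftrightarrow> f = e" for f by auto
  then show ?case by (simp add: bexs_def)
next
  case (Cons x xs)
  then have z: "z \<noteq> x" "z \<notin> set xs" by auto
  have "sat M e E (bexs (x # xs) z p) \<longleftrightarrow> (\<exists>a. a \<prec> e z \<oplus> \<one> \<and> sat M (e(x := a)) E (bexs xs z p))"
    using z by (simp add: bexs_def)
  also have "\<dots> \<longleftrightarrow> (\<exists>a f. a \<prec> e z \<oplus> \<one> \<and> (\<forall>v. v \<notin> set xs \<longrightarrow> f v = (e(x := a)) v)
      \<and> (\<forall>v\<in>set xs. f v \<prec> e z \<oplus> \<one>) \<and> sat M f E p)"
    using z Cons.IH by simp
  also have "\<dots> \<longleftrightarrow> (\<exists>f. (\<forall>v. v \<notin> set (x # xs) \<longrightarrow> f v = e v)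
      \<and> (\<forall>v\<in>set (x # xs). f v \<prec> e z \<oplus> \<one>) \<and> sat M f E p)" (is "?L \<longleftrightarrow> ?R")
  proof
    assume ?L
    then obtain a f where f: "a \<prec> e z \<oplus> \<one>" "\<forall>v. v \<notin> set xs \<longrightarrow> f v = (e(x := a)) v"
      "\<forall>v\<in>set xs. f v \<prec> e z \<oplus> \<one>" "sat M f E p" by blast
    \<comment> \<open>If \<open>x\<close> recurs in \<open>xs\<close>, the inner quantifier fixes
      \<open>f x\<close> and bounds it; otherwise \<open>f x\<close> is \<open>a\<close>.\<close>
    then have "f x \<prec> e z \<oplus> \<one>" by (cases "x \<in> set xs") auto
    with f show ?R by (intro exI[of _ f]) auto
  next
    assume ?R
    then obtain f where "\<forall>v. v \<notin> set (x # xs) \<longrightarrow> f v = e v"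
      "\<forall>v\<in>set (x # xs). f v \<prec> e z \<oplus> \<one>" "sat M f E p" by blast
    then show ?L by (intro exI[of _ "f x"] exI[of _ f]) auto
  qed
  finally show ?case .
qed

lemma tm_vars_tuple [simp]: "tm_vars (tuple xs) = set xs"
  by (induction xs) (auto simp: tuple_def pair_def)

lemma tuple_inject:
  "tm_val M e (tuple xs) = tm_val M e' (tuple xs) \<longleftrightarrow> (\<forall>v\<in>set xs. e v = e' v)"
  by (induction xs) (auto simp: tuple_def)

lemma less_trans: "a \<prec> b \<Longrightarrow> b \<prec> c \<Longrightarrow> a \<prec> c"
  unfolding less_iff by (metis add_assoc)

lemma le_tuple: "v \<in> set xs \<Longrightarrow> e v \<prec> tm_val M e (tuple xs) \<oplus> \<one>"
proof (induction xs)
  case (Cons x xs)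
  have "tm_val M e (tuple xs) \<prec> tm_val M e (tuple (x # xs)) \<oplus> \<one>"
    by (simp add: tuple_def snd_le_pr)
  moreover have "e x \<prec> tm_val M e (tuple (x # xs)) \<oplus> \<one>"
    by (simp add: tuple_def fst_le_pr)
  ultimately show ?case using Cons less_add_one_iff less_trans by auto
qed simp

section \<open>Projections and comprehension for \<open>Sigma01\<close> formulas\<close>

text \<open>The vertex set in the application below: with all numbers as vertices, every finite set
  code is an edge.\<close>

lemma UNIV_in_sets: "UNIV \<in> sets M"
  using bounded_comprehension[of "Eq Zero Zero" some_sets "\<lambda>_. \<zero>" 0]
  by (simp add: bounded_fm.intros range_some_sets)

lemma projection_in_sets:
  assumes hyp: "models M {hypergraph_sentence}" and Q: "Q \<in> sets M"
  shows "{a. \<exists>b. pr M a b \<in> Q} \<in> sets M"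
proof -
  text \<open>The sequence sends a pair \<open>(a, b)\<close> in \<open>Q\<close> to the code of \<open>{i. i < a + 1}\<close> and every other
    number to the code of the empty set.\<close>
  define val where "val n c \<longleftrightarrow>
    (\<exists>a b. n = pr M a b \<and> n \<in> Q \<and> c = pr M (a \<oplus> \<one>) \<zero>) \<or>
    (\<nexists>a b. n = pr M a b \<and> n \<in> Q) \<and> c = \<zero>" for n c
  define F where "F = {p. \<exists>n c. p = pr M n c \<and> val n c}"
  \<comment> \<open>Variable 0 is the pair to be tested, 1 and 2 are its components \<open>n\<close>
    and \<open>c\<close>, 3 and 4 the components of \<open>n\<close>; set variable 0 is
    \<open>Q\<close>. All decoding is bounded, which lets bounded comprehension form
    \<open>F\<close>.\<close>
  define inQ where "inQ p = bexs [3, 4] 1 (Conj (Eq (Var 1) (pair (Var 3) (Var 4)))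
    (Conj (Mem (Var 1) 0) p))" for p
  define Ff where "Ff = bexs [1, 2] 0 (Conj (Eq (Var 0) (pair (Var 1) (Var 2)))
    (Disj (inQ (Eq (Var 2) (pair (Add (Var 3) One) Zero)))
      (Conj (Neg (inQ (Eq Zero Zero))) (Eq (Var 2) Zero))))"
  have bounded: "bounded_fm Ff"
    unfolding Ff_def inQ_def by (intro bounded_bexs bounded_fm.intros) auto
  have sat_inQ: "sat M e E (inQ p) \<longleftrightarrow>
      (\<exists>a b. e 1 = pr M a b \<and> e 1 \<in> E 0 \<and> sat M (e(3 := a, 4 := b)) E p)" for e E p
    unfolding inQ_def bexs_def by (auto simp: fst_le_pr snd_le_pr)
  have sat_Ff: "sat M e (\<lambda>_. Q) Ff \<longleftrightarrow> (\<exists>n c. e 0 = pr M n c \<and> val n c)" for e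
  proof -
    have "sat M e (\<lambda>_. Q) Ff \<longleftrightarrow>
        (\<exists>n. n \<prec> e 0 \<oplus> \<one> \<and> (\<exists>c. c \<prec> e 0 \<oplus> \<one> \<and> e 0 = pr M n c \<and> val n c))"
      by (simp add: Ff_def bexs_def sat_inQ val_def)
    then show ?thesis using fst_le_pr snd_le_pr by auto
  qed
  have F_eq: "F = {a. sat M ((\<lambda>_. \<zero>)(0 := a)) (\<lambda>_. Q) Ff}"
    unfolding F_def sat_Ff by simp
  have F_sets: "F \<in> sets M"
    unfolding F_eq by (rule bounded_comprehension) (use bounded Q in auto)
  have in_F: "pr M n c \<in> F \<longleftrightarrow> val n c" for n c by (auto simp: F_def)
  have uniq: "\<exists>!c. val n c" for n
    unfolding val_def by (cases "\<exists>a b. n = pr M a b \<and> n \<in> Q") auto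
  \<comment> \<open>The default value \<open>\<zero>\<close> equals
    \<open>pr M \<zero> \<zero>\<close>, the code of the empty initial segment.\<close>
  have edge: "edge M UNIV c" if "val n c" for n c
    using that fin_code_initial_segment fin_code_initial_segment[of \<zero>]
    by (auto simp: val_def edge_def)
  have "sat M (\<lambda>_. \<zero>) some_sets hypergraph_sentence"
    using hyp range_some_sets by (auto simp: models_def)
  from this[unfolded sat_hypergraph_sentence, rule_format, OF UNIV_in_sets F_sets]
  have "\<exists>S\<in>sets M. (\<forall>c\<in>S. edge M UNIV c) \<and> (\<forall>c. c \<in> S \<longleftrightarrow> (\<exists>n. pr M n c \<in> F))"
    unfolding in_F using uniq edge F_def by blast
  then obtain S where S: "S \<in> sets M" "\<And>c. c \<in> S \<longleftrightarrow> (\<exists>n. val n c)"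
    using in_F by auto
  \<comment> \<open>The shift from \<open>a\<close> to \<open>a \<oplus> \<one>\<close> keeps the
    codes attached to pairs in \<open>Q\<close> apart from the default value, so such a code is in
    \<open>S\<close> only on account of a pair in \<open>Q\<close>.\<close>
  have nz: "pr M (a \<oplus> \<one>) \<zero> \<noteq> \<zero>" for a
    using pr_inject[of "a \<oplus> \<one>" \<zero> \<zero> \<zero>] by simp
  have "pr M (a \<oplus> \<one>) \<zero> \<in> S \<longleftrightarrow> (\<exists>b. pr M a b \<in> Q)" for a
    unfolding S val_def using nz by auto
  moreover have "{a. sat M ((\<lambda>_. \<zero>)(0 := a)) (\<lambda>_. S) (Mem (pair (Add (Var 0) One) Zero) 0)} \<in> sets M"
    by (rule bounded_comprehension) (use S(1) in \<open>auto intro: bounded_fm.intros\<close>)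
  ultimately show ?thesis by simp
qed

text \<open>Bounded comprehension forms the set of codes of pairs \<open>(a, b)\<close> satisfying
  \<open>p\<close>, with \<open>w\<close> holding the code; the set wanted is its
  projection.\<close>

lemma Sigma01_comprehension:
  assumes hyp: "models M {hypergraph_sentence}"
    and "bounded_fm p" "range E \<subseteq> sets M" "x \<noteq> z"
  shows "{a. \<exists>b. sat M (e(z := a, x := b)) E p} \<in> sets M"
proof -
  obtain w where w: "w \<notin> free_num_vars p \<union> {x, z}"
    using ex_fresh[of "free_num_vars p \<union> {x, z}"] by auto
  define q where "q = bexs [z, x] w (Conj (Eq (Var w) (pair (Var z) (Var x))) p)"
  have "bounded_fm q" unfolding q_def using assms(2) w
    by (intro bounded_bexs bounded_fm.intros) auto
  then have Q: "{c. sat M (e(w := c)) E q} \<in> sets M"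
    using assms(3) by (rule bounded_comprehension)
  have "sat M (e(w := c, z := a, x := b)) E p = sat M (e(z := a, x := b)) E p" for a b c
    using w by (intro sat_cong) auto
  then have "sat M (e(w := pr M a b)) E q \<longleftrightarrow> sat M (e(z := a, x := b)) E p" for a b
    using w \<open>x \<noteq> z\<close> unfolding q_def bexs_def by (auto simp: fst_le_pr snd_le_pr)
  with projection_in_sets[OF hyp Q] show ?thesis by simp
qed

text \<open>Coding the free variables into a tuple makes the reduction uniform in the number parameters.\<close>

lemma ex_bounded_reduct:
  assumes hyp: "models M {hypergraph_sentence}"
    and "bounded_fm p" "range E \<subseteq> sets M"
  shows "\<exists>t. \<exists>A\<in>sets M. \<forall>e. (\<exists>b. sat M (e(x := b)) E p) \<longleftrightarrow> tm_val M e t \<in> A"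
proof -
  obtain z where z: "z \<notin> free_num_vars p \<union> {x}"
    using ex_fresh[of "free_num_vars p \<union> {x}"] by auto
  define xs where "xs = sorted_list_of_set (free_num_vars p - {x})"
  have xs: "set xs = free_num_vars p - {x}" by (simp add: xs_def)
  have z_xs: "z \<notin> set xs" using z xs by auto
  define q where "q = bexs xs z (Conj (Eq (Var z) (tuple xs)) p)"
  \<comment> \<open>\<open>A\<close> must not depend on the environment. A fixed one suffices, since
    \<open>q\<close> recovers the free variables of \<open>p\<close> other than \<open>x\<close>
    from the tuple in \<open>z\<close>.\<close>
  define e0 :: "nat \<Rightarrow> 'a" where "e0 = (\<lambda>_. \<zero>)"
  define A where "A = {a. \<exists>b. sat M (e0(z := a, x := b)) E q}"
  have "bounded_fm q" unfolding q_def using assms(2) z_xs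
    by (intro bounded_bexs bounded_fm.intros) auto
  then have A: "A \<in> sets M"
    unfolding A_def using z by (intro Sigma01_comprehension[OF hyp _ assms(3)]) auto
  have "(\<exists>b. sat M (e(x := b)) E p) \<longleftrightarrow> tm_val M e (tuple xs) \<in> A" (is "?L \<longleftrightarrow> ?R") for e
  proof
    assume ?L
    then obtain b where b: "sat M (e(x := b)) E p" by blast
    let ?a = "tm_val M e (tuple xs)"
    define f where "f v = (if v \<in> set xs then e v else (e0(z := ?a, x := b)) v)" for v
    have "tm_val M f (tuple xs) = ?a" by (auto simp: tuple_inject f_def)
    moreover have "sat M f E p"
      using b by (subst sat_cong[where e' = "e(x := b)" and E' = E]) (auto simp: f_def xs)
    moreover have "f v \<prec> ?a \<oplus> \<one>" if "v \<in> set xs" for v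
      using that le_tuple by (simp add: f_def)
    ultimately have "sat M (e0(z := ?a, x := b)) E q"
      unfolding q_def sat_bexs[OF z_xs] using z z_xs
      by (intro exI[of _ f]) (auto simp: f_def)
    then show ?R by (auto simp: A_def)
  next
    assume ?R
    then obtain b f where f: "\<And>v. v \<notin> set xs \<Longrightarrow> f v = (e0(z := tm_val M e (tuple xs), x := b)) v"
      "f z = tm_val M f (tuple xs)" "sat M f E p"
      unfolding A_def q_def sat_bexs[OF z_xs] by auto
    \<comment> \<open>The quantifier block does not touch \<open>z\<close>, so the decoded tuple is
      that of \<open>e\<close>, and injectivity makes \<open>f\<close> and \<open>e\<close> agree on
      \<open>xs\<close>.\<close>
    have "f z = tm_val M e (tuple xs)" using f(1)[OF z_xs] z by simp
    with f(2) have "\<forall>v\<in>set xs. f v = e v" by (simp add: tuple_inject[symmetric])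
    moreover have "f x = b" using f(1)[of x] xs by simp
    ultimately have "sat M (e(x := b)) E p"
      using f(3) by (subst sat_cong[where e' = f and E' = E]) (auto simp: xs)
    then show ?L by blast
  qed
  with A show ?thesis by blast
qed

section \<open>Reducing arithmetical formulas to membership\<close>

lemma bounded_reduct:
  assumes "models M {hypergraph_sentence}" "bounded_fm p" "range E \<subseteq> sets M"
  shows "\<exists>t. \<exists>A\<in>sets M. \<forall>e. sat M e E p \<longleftrightarrow> tm_val M e t \<in> A"
proof -
  obtain x where "x \<notin> free_num_vars p" using ex_fresh by force
  then show ?thesis using ex_bounded_reduct[OF assms, of x] by (simp add: sat_upd_fresh)
qed

text \<open>Each immediate subformula becomes an atom with a set parameter, so connectives and
  quantifiers only ever act on bounded formulas and are absorbed again; the new sets replace the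
  assignment \<open>E\<close>. As \<open>t\<close> and \<open>A\<close> serve every
  \<open>e\<close>, the quantifier cases can vary the value of \<open>x\<close>.\<close>

lemma arithmetical_reduct:
  assumes hyp: "models M {hypergraph_sentence}" and E: "range E \<subseteq> sets M"
  shows "arithmetical p \<Longrightarrow> \<exists>t. \<exists>A\<in>sets M. \<forall>e. sat M e E p \<longleftrightarrow> tm_val M e t \<in> A"
proof (induction p)
  case (Eq s t)
  show ?case by (rule bounded_reduct[OF hyp _ E]) (rule bounded_fm.intros)
next
  case (Less s t)
  show ?case by (rule bounded_reduct[OF hyp _ E]) (rule bounded_fm.intros)
next
  case (Mem t X)
  show ?case by (rule bounded_reduct[OF hyp _ E]) (rule bounded_fm.intros)
next
  case (Neg p)
  then obtain t A where t: "A \<in> sets M" "\<And>e. sat M e E p \<longleftrightarrow> tm_val M e t \<in> A" by auto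
  then show ?case
    using bounded_reduct[OF hyp, of "Neg (Mem t 0)" "\<lambda>_. A"] by (auto simp: bounded_fm.intros)
next
  case (Conj p q)
  then obtain t A u B where t: "A \<in> sets M" "\<And>e. sat M e E p \<longleftrightarrow> tm_val M e t \<in> A"
    "B \<in> sets M" "\<And>e. sat M e E q \<longleftrightarrow> tm_val M e u \<in> B" by auto
  then show ?case
    using bounded_reduct[OF hyp, of "Conj (Mem t 0) (Mem u 1)" "(\<lambda>_. B)(0 := A)"]
    by (auto simp: bounded_fm.intros)
next
  case (Disj p q)
  then obtain t A u B where t: "A \<in> sets M" "\<And>e. sat M e E p \<longleftrightarrow> tm_val M e t \<in> A"
    "B \<in> sets M" "\<And>e. sat M e E q \<longleftrightarrow> tm_val M e u \<in> B" by auto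
  then show ?case
    using bounded_reduct[OF hyp, of "Disj (Mem t 0) (Mem u 1)" "(\<lambda>_. B)(0 := A)"]
    by (auto simp: bounded_fm.intros)
next
  case (Imp p q)
  then obtain t A u B where t: "A \<in> sets M" "\<And>e. sat M e E p \<longleftrightarrow> tm_val M e t \<in> A"
    "B \<in> sets M" "\<And>e. sat M e E q \<longleftrightarrow> tm_val M e u \<in> B" by auto
  then show ?case
    using bounded_reduct[OF hyp, of "Imp (Mem t 0) (Mem u 1)" "(\<lambda>_. B)(0 := A)"]
    by (auto simp: bounded_fm.intros)
next
  case (Iff p q)
  then obtain t A u B where t: "A \<in> sets M" "\<And>e. sat M e E p \<longleftrightarrow> tm_val M e t \<in> A"
    "B \<in> sets M" "\<And>e. sat M e E q \<longleftrightarrow> tm_val M e u \<in> B" by auto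
  then show ?case
    using bounded_reduct[OF hyp, of "Iff (Mem t 0) (Mem u 1)" "(\<lambda>_. B)(0 := A)"]
    by (auto simp: bounded_fm.intros)
next
  case (AllN x p)
  then obtain t A where t: "A \<in> sets M" "\<And>e. sat M e E p \<longleftrightarrow> tm_val M e t \<in> A" by auto
  \<comment> \<open>The universal quantifier is a negated existential one: \<open>B\<close> captures
    the existence of a counterexample, \<open>C\<close> below its negation.\<close>
  then obtain u B where u: "B \<in> sets M"
    "\<And>e. (\<exists>b. tm_val M (e(x := b)) t \<notin> A) \<longleftrightarrow> tm_val M e u \<in> B"
    using ex_bounded_reduct[OF hyp, of "Neg (Mem t 0)" "\<lambda>_. A" x] by (auto simp: bounded_fm.intros)
  then obtain v C where "C \<in> sets M" "\<And>e. tm_val M e u \<notin> B \<longleftrightarrow> tm_val M e v \<in> C"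
    using bounded_reduct[OF hyp, of "Neg (Mem u 0)" "\<lambda>_. B"] by (auto simp: bounded_fm.intros)
  then show ?case using t(2) u(2) by (auto simp del: fun_upd_apply) (metis)
next
  case (ExN x p)
  then obtain t A where t: "A \<in> sets M" "\<And>e. sat M e E p \<longleftrightarrow> tm_val M e t \<in> A" by auto
  then show ?case
    using ex_bounded_reduct[OF hyp, of "Mem t 0" "\<lambda>_. A" x] by (auto simp: bounded_fm.intros)
qed simp_all

lemma arithmetical_set:
  assumes "models M {hypergraph_sentence}" "range E \<subseteq> sets M" "arithmetical p"
  shows "{a. sat M (e(x := a)) E p} \<in> sets M"
proof -
  obtain t A where "A \<in> sets M" "\<And>e. sat M e E p \<longleftrightarrow> tm_val M e t \<in> A"
    using arithmetical_reduct[OF assms] by blast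
  then show ?thesis
    using bounded_comprehension[of "Mem t 0" "\<lambda>_. A" e x] by (auto simp: bounded_fm.intros)
qed

lemma hypergraph_imp_ACA0:
  assumes "models M {hypergraph_sentence}"
  shows "models M ACA0"
proof -
  have "sat M e E (comprehension_axiom X x p)"
    if "arithmetical p" "X \<notin> free_set_vars p" "range E \<subseteq> sets M" for X x p e E
    unfolding comprehension_axiom_def sat.simps using arithmetical_set[OF assms that(3,1), of e x] that(2)
    by (auto simp: sat_upd_set_fresh intro!: bexI[of _ "{a. sat M (e(x := a)) E p}"])
  then show ?thesis using rca0
    by (auto simp: models_def ACA0_def arithmetical_comprehension_def)
qed

section \<open>The hypergraph principle from arithmetical comprehension\<close>

lemma ACA0_imp_hypergraph:
  assumes "models M ACA0"
  shows "models M {hypergraph_sentence}"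
proof -
  have "\<exists>S\<in>sets M. \<forall>c. c \<in> S \<longleftrightarrow> (\<exists>n. pr M n c \<in> F)" if "F \<in> sets M" for F
  proof -
    \<comment> \<open>\<open>S\<close> is the range of \<open>F\<close>: set variable 1 is
      \<open>F\<close> and variable 2 the new set. That its members are edges is inherited from the
      values of \<open>F\<close>.\<close>
    have "comprehension_axiom 2 1 (ExN 0 (Mem (pair (Var 0) (Var 1)) 1)) \<in> ACA0"
      unfolding ACA0_def arithmetical_comprehension_def by fastforce
    then have "sat M (\<lambda>_. \<zero>) (\<lambda>_. F) (comprehension_axiom 2 1 (ExN 0 (Mem (pair (Var 0) (Var 1)) 1)))"
      using assms that unfolding models_def by auto
    then show ?thesis by (simp add: comprehension_axiom_def)
  qed
  then show ?thesis
    unfolding models_def by (simp add: sat_hypergraph_sentence) meson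
qed

end

theorem theorem3:
  fixes M :: "'a interp"
  assumes "L2_structure M" and "models M RCA0"
  shows "models M ACA0 \<longleftrightarrow> models M {hypergraph_sentence}"
proof -
  interpret rca0_model M using assms by unfold_locales
  show ?thesis using hypergraph_imp_ACA0 ACA0_imp_hypergraph by blast
qed

end
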